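(* Let $X\subset\mathbb{R}^N$ be a geodesic subspace that is compact and path-connected in the topology of its induced length metric $d^L_X$. Then $d^\varepsilon_X$ converges to $d^L_X$ uniformly on $X\times X$ as $\varepsilon\to0$.
   Context: **Geodesic subspaces.** For $X\subset\mathbb{R}^N$ with the Euclidean metric, the induced length metric $d^L_X(x_1,x_2)$ is the infimum of the (Euclidean) lengths of continuous paths in $X$ joining $x_1,x_2$. $X$ is a geodesic subspace if this infimum is always attained by some path in $X$ (a shortest path). **Path metric.** For $\varepsilon>0$ and non-empty $Y\subset\mathbb{R}^N$, an $\varepsilon$-path of $Y$ from $a$ to $b$ is a finite sequence $y_0=a,y_1,\dots,y_{k+1}=b$ in $Y$ with $\|y_i-y_{i+1}\|<\varepsilon$ for all $i$; its length is $\sum_{i=0}^k\|y_i-y_{i+1}\|$. $d^\varepsilon_Y(a,b)$ is the infimum of lengths of $\varepsilon$-paths of $Y$ from $a$ to $b$. *)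

theory Defs
  imports "HOL-Analysis.Analysis"
begin

definition path_length :: "(real \<Rightarrow> 'a::real_normed_vector) \<Rightarrow> ennreal" where
  "path_length g =
     (SUP (n, t) \<in> {(n::nat, t::nat \<Rightarrow> real). t 0 = 0 \<and> t n = 1 \<and> (\<forall>i<n. t i \<le> t (Suc i))}.
        \<Sum>i<n. ennreal (norm (g (t i) - g (t (Suc i)))))"

definition paths_between :: "'a::real_normed_vector set \<Rightarrow> 'a \<Rightarrow> 'a \<Rightarrow> (real \<Rightarrow> 'a) set" where
  "paths_between X x y =
     {g. path g \<and> path_image g \<subseteq> X \<and> pathstart g = x \<and> pathfinish g = y}"

text \<open>Infima of lengths are taken in \<^typ>\<open>ennreal\<close>, so that the infimum over the empty set is \<open>\<infinity>\<close>.\<close>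

definition length_dist :: "'a::real_normed_vector set \<Rightarrow> 'a \<Rightarrow> 'a \<Rightarrow> ennreal" where
  "length_dist X x y = (INF g \<in> paths_between X x y. path_length g)"

definition geodesic_subspace :: "'a::real_normed_vector set \<Rightarrow> bool" where
  "geodesic_subspace X \<longleftrightarrow>
     (\<forall>x\<in>X. \<forall>y\<in>X. \<exists>g \<in> paths_between X x y. path_length g = length_dist X x y)"

text \<open>The metric topology of an extended metric; \<^const>\<open>Metric_space.mtopology\<close> needs a
  real-valued one, and the two agree where both make sense (see below).\<close>

definition emetric_topology :: "'a set \<Rightarrow> ('a \<Rightarrow> 'a \<Rightarrow> ennreal) \<Rightarrow> 'a topology" where
  "emetric_topology X d =
     topology (\<lambda>U. U \<subseteq> X \<and> (\<forall>x\<in>U. \<exists>r>0. {y \<in> X. d x y < ennreal r} \<subseteq> U))"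

lemma openin_emetric_topology:
  "openin (emetric_topology X d) U \<longleftrightarrow>
     U \<subseteq> X \<and> (\<forall>x\<in>U. \<exists>r>0. {y \<in> X. d x y < ennreal r} \<subseteq> U)"
proof -
  have "istopology (\<lambda>U. U \<subseteq> X \<and> (\<forall>x\<in>U. \<exists>r>0. {y \<in> X. d x y < ennreal r} \<subseteq> U))"
    unfolding istopology_def
  proof (intro conjI allI impI)
    fix S T assume S: "S \<subseteq> X \<and> (\<forall>x\<in>S. \<exists>r>0. {y \<in> X. d x y < ennreal r} \<subseteq> S)"
      and T: "T \<subseteq> X \<and> (\<forall>x\<in>T. \<exists>r>0. {y \<in> X. d x y < ennreal r} \<subseteq> T)"
    show "S \<inter> T \<subseteq> X" using S by blast
    show "\<forall>x\<in>S \<inter> T. \<exists>r>0. {y \<in> X. d x y < ennreal r} \<subseteq> S \<inter> T"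
    proof
      fix x assume "x \<in> S \<inter> T"
      then obtain r s where "r > 0" "{y \<in> X. d x y < ennreal r} \<subseteq> S"
        "s > 0" "{y \<in> X. d x y < ennreal s} \<subseteq> T" using S T by blast
      moreover have "d x y < ennreal r \<and> d x y < ennreal s" if "d x y < ennreal (min r s)" for y
        using that by (meson ennreal_leI less_le_trans min.cobounded1 min.cobounded2)
      ultimately have "min r s > 0 \<and> {y \<in> X. d x y < ennreal (min r s)} \<subseteq> S \<inter> T"
        by (simp add: subset_iff)
      then show "\<exists>r>0. {y \<in> X. d x y < ennreal r} \<subseteq> S \<inter> T" by blast
    qed
  next
    fix K assume K: "\<forall>S\<in>K. S \<subseteq> X \<and> (\<forall>x\<in>S. \<exists>r>0. {y \<in> X. d x y < ennreal r} \<subseteq> S)"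
    show "\<Union>K \<subseteq> X" using K by blast
    show "\<forall>x\<in>\<Union>K. \<exists>r>0. {y \<in> X. d x y < ennreal r} \<subseteq> \<Union>K"
    proof
      fix x assume "x \<in> \<Union>K"
      then obtain S r where "S \<in> K" "r > 0" "{y \<in> X. d x y < ennreal r} \<subseteq> S"
        using K by blast
      then show "\<exists>r>0. {y \<in> X. d x y < ennreal r} \<subseteq> \<Union>K" by blast
    qed
  qed
  then show ?thesis
    by (simp add: emetric_topology_def topology_inverse')
qed

lemma emetric_topology_eq_mtopology:
  assumes "Metric_space X d"
  shows "emetric_topology X (\<lambda>x y. ennreal (d x y)) = Metric_space.mtopology X d"
proof -
  interpret Metric_space X d by fact
  have "mball x r = {y \<in> X. ennreal (d x y) < ennreal r}" if "x \<in> X" for x r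
    using that by (auto simp: ennreal_less_iff)
  then have "openin (emetric_topology X (\<lambda>x y. ennreal (d x y))) U = openin mtopology U" for U
    unfolding openin_emetric_topology openin_mtopology by (metis subsetD)
  then show ?thesis by (simp add: topology_eq)
qed

definition eps_paths :: "real \<Rightarrow> 'a::real_normed_vector set \<Rightarrow> 'a \<Rightarrow> 'a \<Rightarrow> (nat \<times> (nat \<Rightarrow> 'a)) set" where
  "eps_paths \<epsilon> Y a b =
     {(k, y). y 0 = a \<and> y (Suc k) = b \<and> (\<forall>i\<le>Suc k. y i \<in> Y) \<and>
              (\<forall>i\<le>k. norm (y i - y (Suc i)) < \<epsilon>)}"

definition eps_dist :: "real \<Rightarrow> 'a::real_normed_vector set \<Rightarrow> 'a \<Rightarrow> 'a \<Rightarrow> ennreal" where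
  "eps_dist \<epsilon> Y a b =
     (INF (k, y) \<in> eps_paths \<epsilon> Y a b. \<Sum>i\<le>k. ennreal (norm (y i - y (Suc i))))"

end

theory Submission
  imports Defs
begin

text \<open>Sampling a path finely gives \<open>eps_dist \<epsilon> X \<le> length_dist X\<close>. Conversely, \<open>\<epsilon>\<close>-paths of length
  about \<open>L\<close> for all small \<open>\<epsilon>\<close> are step functions on \<open>[0,1]\<close> that are \<open>L\<close>-Lipschitz up to an error
  of order \<open>\<epsilon>\<close>; as \<open>X\<close> is compact, they accumulate at an \<open>L\<close>-Lipschitz path in \<open>X\<close>. Hence
  \<open>length_dist X\<close> is the pointwise supremum of the \<open>\<epsilon>\<close>-distances and inherits symmetry and the
  triangle inequality from them. Compactness for the length metric makes the convergence uniform.\<close>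

section \<open>Elementary properties of the \<epsilon>-distances\<close>

lemma eps_dist_le_sum:
  assumes "y 0 = a" "y (Suc k) = b" "\<And>i. i \<le> Suc k \<Longrightarrow> y i \<in> Y"
    and "\<And>i. i \<le> k \<Longrightarrow> norm (y i - y (Suc i)) < \<epsilon>"
  shows "eps_dist \<epsilon> Y a b \<le> (\<Sum>i\<le>k. ennreal (norm (y i - y (Suc i))))"
proof -
  have "(k, y) \<in> eps_paths \<epsilon> Y a b"
    using assms by (auto simp: eps_paths_def)
  then show ?thesis
    unfolding eps_dist_def by (rule INF_lower2) simp
qed

lemma le_eps_distI:
  assumes "\<And>k y. y 0 = a \<Longrightarrow> y (Suc k) = b \<Longrightarrow> (\<And>i. i \<le> Suc k \<Longrightarrow> y i \<in> Y) \<Longrightarrow>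
      (\<And>i. i \<le> k \<Longrightarrow> norm (y i - y (Suc i)) < \<epsilon>) \<Longrightarrow> c \<le> (\<Sum>i\<le>k. ennreal (norm (y i - y (Suc i))))"
  shows "c \<le> eps_dist \<epsilon> Y a b"
  unfolding eps_dist_def
  by (rule INF_greatest) (auto simp: eps_paths_def simp del: sum_ennreal intro!: assms)

lemma eps_dist_lessE:
  assumes "eps_dist \<epsilon> Y a b < c"
  obtains k y where "y 0 = a" "y (Suc k) = b" "\<And>i. i \<le> Suc k \<Longrightarrow> y i \<in> Y"
    "\<And>i. i \<le> k \<Longrightarrow> norm (y i - y (Suc i)) < \<epsilon>"
    "(\<Sum>i\<le>k. ennreal (norm (y i - y (Suc i)))) < c"
  using assms that unfolding eps_dist_def INF_less_iff by (auto simp: eps_paths_def)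

lemma eps_dist_antimono:
  assumes "\<delta> \<le> \<epsilon>"
  shows "eps_dist \<epsilon> Y a b \<le> eps_dist \<delta> Y a b"
proof (rule le_eps_distI)
  fix k y
  assume "y 0 = a" "y (Suc k) = b" "\<And>i. i \<le> Suc k \<Longrightarrow> y i \<in> Y"
    "\<And>i. i \<le> k \<Longrightarrow> norm (y i - y (Suc i)) < \<delta>"
  then show "eps_dist \<epsilon> Y a b \<le> (\<Sum>i\<le>k. ennreal (norm (y i - y (Suc i))))"
    using assms by (intro eps_dist_le_sum) (auto intro: less_le_trans)
qed

lemma eps_dist_commute: "eps_dist \<epsilon> Y a b = eps_dist \<epsilon> Y b a"
proof -
  have "eps_dist \<epsilon> Y b a \<le> eps_dist \<epsilon> Y a b" for a b
  proof (rule le_eps_distI)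
    fix k y
    assume y: "y 0 = a" "y (Suc k) = b" "\<And>i. i \<le> Suc k \<Longrightarrow> y i \<in> Y"
      "\<And>i. i \<le> k \<Longrightarrow> norm (y i - y (Suc i)) < \<epsilon>"
    define w where "w i = y (Suc k - i)" for i
    have w: "norm (w i - w (Suc i)) = norm (y (k - i) - y (Suc (k - i)))" if "i \<le> k" for i
      using that by (simp add: w_def Suc_diff_le norm_minus_commute)
    have "eps_dist \<epsilon> Y b a \<le> (\<Sum>i\<le>k. ennreal (norm (w i - w (Suc i))))"
      by (rule eps_dist_le_sum) (use y w in \<open>auto simp: w_def\<close>)
    also have "\<dots> = (\<Sum>i\<le>k. ennreal (norm (y (k - i) - y (Suc (k - i)))))"
      using w by (intro sum.cong) auto
    also have "\<dots> = (\<Sum>i\<le>k. ennreal (norm (y i - y (Suc i))))"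
      using sum.nat_diff_reindex[of "\<lambda>i. ennreal (norm (y i - y (Suc i)))" "Suc k"]
      by (simp add: lessThan_Suc_atMost)
    finally show "eps_dist \<epsilon> Y b a \<le> (\<Sum>i\<le>k. ennreal (norm (y i - y (Suc i))))" .
  qed
  then show ?thesis by (intro antisym)
qed

text \<open>A nearly optimal \<epsilon>-path to \<open>b\<close> is prolonged by the single jump to
  \<open>c\<close>.\<close>

lemma eps_dist_step:
  assumes "c \<in> Y" "norm (b - c) < \<epsilon>"
  shows "eps_dist \<epsilon> Y a c \<le> eps_dist \<epsilon> Y a b + ennreal (norm (b - c))"
proof (rule ennreal_le_epsilon)
  fix e :: real
  assume fin: "eps_dist \<epsilon> Y a b + ennreal (norm (b - c)) < top" and "0 < e"
  \<comment> \<open>The finite right-hand side makes the distance itself finite, so adding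
    \<open>e\<close> increases it strictly.\<close>
  then have "eps_dist \<epsilon> Y a b < eps_dist \<epsilon> Y a b + ennreal e"
    by (metis ennreal_add_left_cancel_less ennreal_less_zero_iff add_0_right ennreal_add_eq_top less_top)
  then obtain k y where y: "y 0 = a" "y (Suc k) = b" "\<And>i. i \<le> Suc k \<Longrightarrow> y i \<in> Y"
    "\<And>i. i \<le> k \<Longrightarrow> norm (y i - y (Suc i)) < \<epsilon>"
    and sum: "(\<Sum>i\<le>k. ennreal (norm (y i - y (Suc i)))) < eps_dist \<epsilon> Y a b + ennreal e"
    by (rule eps_dist_lessE) blast
  define w where "w = y(Suc (Suc k) := c)"
  have "eps_dist \<epsilon> Y a c \<le> (\<Sum>i\<le>Suc k. ennreal (norm (w i - w (Suc i))))"
    by (rule eps_dist_le_sum) (use y assms in \<open>auto simp: w_def le_Suc_eq\<close>)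
  also have "\<dots> = (\<Sum>i\<le>k. ennreal (norm (y i - y (Suc i)))) + ennreal (norm (b - c))"
    using y by (simp add: w_def)
  also have "\<dots> \<le> eps_dist \<epsilon> Y a b + ennreal e + ennreal (norm (b - c))"
    using sum by (intro add_mono) auto
  finally show "eps_dist \<epsilon> Y a c \<le> eps_dist \<epsilon> Y a b + ennreal (norm (b - c)) + ennreal e"
    by (simp add: ac_simps)
qed

lemma eps_dist_triangle: "eps_dist \<epsilon> Y a c \<le> eps_dist \<epsilon> Y a b + eps_dist \<epsilon> Y b c"
proof (cases "eps_dist \<epsilon> Y a b = top")
  case False
  \<comment> \<open>With the finite first term moved to the left, only the paths from
    \<open>b\<close> to \<open>c\<close> remain to be bounded. Each is followed jump by jump with
    \<open>eps_dist_step\<close>, which avoids splicing two index sequences.\<close>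
  have "eps_dist \<epsilon> Y a c - eps_dist \<epsilon> Y a b \<le> eps_dist \<epsilon> Y b c"
  proof (rule le_eps_distI)
    fix k y
    assume y: "y 0 = b" "y (Suc k) = c" "\<And>i. i \<le> Suc k \<Longrightarrow> y i \<in> Y"
      "\<And>i. i \<le> k \<Longrightarrow> norm (y i - y (Suc i)) < \<epsilon>"
    have "eps_dist \<epsilon> Y a (y j) \<le> eps_dist \<epsilon> Y a b + (\<Sum>i<j. ennreal (norm (y i - y (Suc i))))"
      if "j \<le> Suc k" for j
      using that
    proof (induction j)
      case (Suc j)
      have "eps_dist \<epsilon> Y a (y (Suc j)) \<le> eps_dist \<epsilon> Y a (y j) + ennreal (norm (y j - y (Suc j)))"
        using Suc.prems y by (intro eps_dist_step) auto
      also have "\<dots> \<le> eps_dist \<epsilon> Y a b + (\<Sum>i<j. ennreal (norm (y i - y (Suc i))))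
          + ennreal (norm (y j - y (Suc j)))"
        using Suc by (intro add_mono) auto
      finally show ?case by (simp add: ac_simps)
    qed (simp add: y)
    from this[of "Suc k"]
    show "eps_dist \<epsilon> Y a c - eps_dist \<epsilon> Y a b \<le> (\<Sum>i\<le>k. ennreal (norm (y i - y (Suc i))))"
      using y False by (simp add: ennreal_minus_le_iff lessThan_Suc_atMost)
  qed
  then show ?thesis
    using False by (simp add: ennreal_minus_le_iff)
qed simp

section \<open>Lower bounds for the length of a path\<close>

text \<open>By uniform continuity a fine equidistant sampling of \<open>g\<close> is an
  \<epsilon>-path, and its length is one of the sums whose supremum is
  \<open>path_length g\<close>.\<close>

lemma eps_dist_le_path_length:
  assumes "\<epsilon> > 0" and g: "g \<in> paths_between X x y"
  shows "eps_dist \<epsilon> X x y \<le> path_length g"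
proof -
  have pg: "path g" "path_image g \<subseteq> X" "g 0 = x" "g 1 = y"
    using g by (auto simp: paths_between_def pathstart_def pathfinish_def)
  then have "uniformly_continuous_on {0..1} g"
    by (simp add: compact_uniformly_continuous path_def)
  then obtain \<delta> where "\<delta> > 0"
    and \<delta>: "\<And>s t. s \<in> {0..1} \<Longrightarrow> t \<in> {0..1} \<Longrightarrow> dist t s < \<delta> \<Longrightarrow> dist (g t) (g s) < \<epsilon>"
    using \<open>\<epsilon> > 0\<close> unfolding uniformly_continuous_on_def by metis
  \<comment> \<open>There are \<open>Suc k\<close> subintervals because the index \<open>k\<close>
    in \<open>eps_paths\<close> counts the intermediate vertices.\<close>
  obtain k where k: "1 / real (Suc k) < \<delta>"
    using \<open>\<delta> > 0\<close> by (metis reals_Archimedean inverse_eq_divide)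
  define t where "t i = real i / real (Suc k)" for i
  have t: "t i \<in> {0..1}" if "i \<le> Suc k" for i
    using that by (auto simp: t_def field_simps)
  have t1: "t (Suc k) = 1"
    by (simp add: t_def del: of_nat_Suc)
  have step: "t (Suc i) - t i = 1 / real (Suc k)" for i
    by (simp add: t_def field_simps)
  have "eps_dist \<epsilon> X x y \<le> (\<Sum>i\<le>k. ennreal (norm (g (t i) - g (t (Suc i)))))"
  proof (rule eps_dist_le_sum)
    show "g (t i) \<in> X" if "i \<le> Suc k" for i
      using t[OF that] pg by (auto simp: path_image_def)
    show "norm (g (t i) - g (t (Suc i))) < \<epsilon>" if "i \<le> k" for i
    proof -
      have "dist (t i) (t (Suc i)) < \<delta>"
        using step[of i] k unfolding dist_real_def abs_minus_commute[of "t i"] by simp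
      then show ?thesis
        using \<delta>[of "t (Suc i)" "t i"] t that by (simp add: dist_norm)
    qed
  qed (use pg t1 in \<open>auto simp: t_def\<close>)
  also have "\<dots> = (\<Sum>i<Suc k. ennreal (norm (g (t i) - g (t (Suc i)))))"
    by (simp add: lessThan_Suc_atMost)
  also have "\<dots> \<le> path_length g"
  proof -
    have "t i \<le> t (Suc i)" for i
      using step[of i] by (smt (verit) divide_nonneg_nonneg of_nat_0_le_iff)
    then have "(Suc k, t) \<in> {(n, t). t 0 = 0 \<and> t n = 1 \<and> (\<forall>i<n. t i \<le> t (Suc i))}"
      using t1 by (simp add: t_def)
    then show ?thesis
      unfolding path_length_def by (rule SUP_upper2) (simp only: prod.case order_refl)
  qed
  finally show ?thesis .
qed

lemma eps_dist_le_length_dist: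
  "\<epsilon> > 0 \<Longrightarrow> eps_dist \<epsilon> X x y \<le> length_dist X x y"
  unfolding length_dist_def by (intro INF_greatest eps_dist_le_path_length)

lemma norm_le_length_dist: "ennreal (norm (x - y)) \<le> length_dist X x y"
  unfolding length_dist_def
proof (rule INF_greatest)
  fix g assume "g \<in> paths_between X x y"
  then have g: "g 0 = x" "g 1 = y"
    by (auto simp: paths_between_def pathstart_def pathfinish_def)
  \<comment> \<open>The function \<open>real\<close> enumerates the coarsest partition 0, 1, whose
    only chord joins the endpoints.\<close>
  have "(1, real) \<in> {(n, t). t 0 = 0 \<and> t n = 1 \<and> (\<forall>i<n. t i \<le> t (Suc i))}"
    by simp
  then show "ennreal (norm (x - y)) \<le> path_length g"
    unfolding path_length_def by (rule SUP_upper2) (simp add: g)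
qed

section \<open>Lipschitz paths as limits of \<epsilon>-paths\<close>

text \<open>Chords are bounded by \<open>L\<close> times the parameter steps, and these telescope to
  1.\<close>

lemma path_length_lipschitz_le:
  fixes g :: "real \<Rightarrow> 'a::real_normed_vector"
  assumes "L \<ge> 0"
    and g: "\<And>s t. s \<in> {0..1} \<Longrightarrow> t \<in> {0..1} \<Longrightarrow> norm (g s - g t) \<le> L * \<bar>s - t\<bar>"
  shows "path_length g \<le> ennreal L"
  unfolding path_length_def
proof (rule SUP_least, clarify)
  fix n and t :: "nat \<Rightarrow> real"
  assume t: "t 0 = 0" "t n = 1" "\<forall>i<n. t i \<le> t (Suc i)"
  have mono: "t i \<le> t j" if "i \<le> j" "j \<le> n" for i j
    using that by (induction rule: dec_induct) (use t in \<open>auto intro: order_trans\<close>)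
  have t01: "t i \<in> {0..1}" if "i \<le> n" for i
    using mono[of 0 i] mono[of i n] t that by simp
  have "(\<Sum>i<n. norm (g (t i) - g (t (Suc i)))) \<le> (\<Sum>i<n. L * (t (Suc i) - t i))"
  proof (rule sum_mono)
    fix i assume "i \<in> {..<n}"
    then show "norm (g (t i) - g (t (Suc i))) \<le> L * (t (Suc i) - t i)"
      using g[of "t i" "t (Suc i)"] t01[of i] t01[of "Suc i"] t by simp
  qed
  also have "\<dots> = L"
    by (simp add: sum_distrib_left[symmetric] sum_lessThan_telescope t)
  finally show "(\<Sum>i<n. ennreal (norm (g (t i) - g (t (Suc i))))) \<le> ennreal L"
    by (simp add: ennreal_leI)
qed

text \<open>Run through the \<open>\<epsilon>\<close>-path with speed \<open>L\<close>, jumping to the next vertex as soon as the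
  accumulated length allows it.\<close>

lemma eps_path_step_function:
  fixes Y :: "'a::real_normed_vector set"
  assumes "L > 0" "\<epsilon> > 0" "eps_dist \<epsilon> Y a b < ennreal L"
  obtains f where "f \<in> {0..1} \<rightarrow> Y" "f 0 = a" "f 1 = b"
    "\<And>s t. s \<in> {0..1} \<Longrightarrow> t \<in> {0..1} \<Longrightarrow> norm (f s - f t) \<le> L * \<bar>s - t\<bar> + \<epsilon>"
proof -
  obtain k y where y: "y 0 = a" "y (Suc k) = b" "\<And>i. i \<le> Suc k \<Longrightarrow> y i \<in> Y"
    "\<And>i. i \<le> k \<Longrightarrow> norm (y i - y (Suc i)) < \<epsilon>"
    and sum: "(\<Sum>i\<le>k. ennreal (norm (y i - y (Suc i)))) < ennreal L"
    using assms(3) by (rule eps_dist_lessE) blast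
  \<comment> \<open>\<open>\<sigma> j\<close> is the length travelled on arrival at vertex
    \<open>j\<close>.\<close>
  define \<sigma> where "\<sigma> j = (\<Sum>i<j. norm (y i - y (Suc i)))" for j
  have \<sigma>_Suc: "\<sigma> (Suc j) = \<sigma> j + norm (y j - y (Suc j))" for j
    by (simp add: \<sigma>_def)
  have \<sigma>_end: "\<sigma> (Suc k) < L"
    using sum \<open>L > 0\<close> by (simp add: \<sigma>_def lessThan_Suc_atMost sum_nonneg ennreal_less_iff)
  have dist_\<sigma>: "norm (y i - y j) \<le> \<sigma> j - \<sigma> i" if "i \<le> j" for i j
    using that
  proof (induction rule: dec_induct)
    case (step j)
    then show ?case
      using norm_triangle_ineq[of "y i - y j" "y j - y (Suc j)"] by (simp add: \<sigma>_Suc)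
  qed simp
  have \<sigma>_mono: "\<sigma> i \<le> \<sigma> j" if "i \<le> j" for i j
    using dist_\<sigma>[OF that] norm_ge_zero[of "y i - y j"] by linarith
  \<comment> \<open>\<open>J t\<close> collects the vertices within reach at time \<open>t\<close>,
    and \<open>m t\<close> is the last of them.\<close>
  define J where "J t = {j. j \<le> Suc k \<and> \<sigma> j \<le> L * t}" for t
  define m where "m t = Max (J t)" for t
  have fin: "finite (J t)" for t
    by (simp add: J_def)
  have ne: "J t \<noteq> {}" if "t \<in> {0..1}" for t
  proof -
    have "0 \<in> J t"
      using that \<open>L > 0\<close> by (simp add: J_def \<sigma>_def)
    then show ?thesis by blast
  qed
  have m: "m t \<le> Suc k" "\<sigma> (m t) \<le> L * t" if "t \<in> {0..1}" for t
    using Max_in[OF fin ne[OF that]] by (auto simp: m_def J_def)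
  have m_next: "L * t < \<sigma> (Suc (m t))" if "t \<in> {0..1}" "m t \<le> k" for t
  proof (rule ccontr)
    assume "\<not> ?thesis"
    then have "Suc (m t) \<in> J t"
      using that by (simp add: J_def)
    then have "Suc (m t) \<le> m t"
      using Max_ge[OF fin] m_def by metis
    then show False by simp
  qed
  have le: "norm (y (m s) - y (m t)) \<le> L * (t - s) + \<epsilon>"
    if "s \<in> {0..1}" "t \<in> {0..1}" "s \<le> t" for s t
  proof -
    have "L * s \<le> L * t"
      using \<open>s \<le> t\<close> \<open>L > 0\<close> by simp
    then have "J s \<subseteq> J t"
      by (auto simp: J_def)
    then have mono: "m s \<le> m t"
      unfolding m_def by (rule Max_mono) (use ne fin that in auto)
    show ?thesis
    proof (cases "m s \<le> k")
      case True
      have "norm (y (m s) - y (m t)) \<le> \<sigma> (m t) - \<sigma> (m s)"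
        using dist_\<sigma>[OF mono] .
      \<comment> \<open>The vertex after \<open>m s\<close> is out of reach at time \<open>s\<close>
        and less than \<epsilon> further along, so \<open>\<sigma> (m s)\<close> exceeds
        \<open>L * s - \<epsilon>\<close>.\<close>
      also have "\<dots> \<le> L * t - (L * s - \<epsilon>)"
        using m(2)[OF that(2)] m_next[OF that(1) True] y(4)[OF True] \<sigma>_Suc[of "m s"] by linarith
      finally show ?thesis by (simp add: algebra_simps)
    next
      case False
      then have "m s = m t"
        using m(1)[OF that(2)] mono by simp
      then show ?thesis
        using \<open>L * s \<le> L * t\<close> \<open>\<epsilon> > 0\<close> by (simp add: algebra_simps)
    qed
  qed
  show thesis
  proof
    show "(\<lambda>t. y (m t)) \<in> {0..1} \<rightarrow> Y"
      using m(1) y(3) by blast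
    \<comment> \<open>The index \<open>m 0\<close> is positive if \<open>y\<close> begins with
      repeated points, but no length has accumulated, so the point is still
      \<open>a\<close>.\<close>
    have "norm (y 0 - y (m 0)) \<le> 0"
    proof -
      have "\<sigma> (m 0) \<le> 0" "\<sigma> 0 = 0"
        using m(2)[of 0] by (simp_all add: \<sigma>_def)
      then show ?thesis
        using dist_\<sigma>[of 0 "m 0"] by linarith
    qed
    then show "y (m 0) = a"
      using y by simp
    \<comment> \<open>The total length is below \<open>L\<close>, so the last vertex is within reach
      at time 1.\<close>
    have "Suc k \<in> J 1"
      using \<sigma>_end by (simp add: J_def)
    then have "Suc k \<le> m 1"
      unfolding m_def using fin by (rule Max_ge[rotated])
    then show "y (m 1) = b"
      using m(1)[of 1] y by (metis atLeastAtMost_iff le_antisym order_refl zero_le_one)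
    show "norm (y (m s) - y (m t)) \<le> L * \<bar>s - t\<bar> + \<epsilon>" if "s \<in> {0..1}" "t \<in> {0..1}" for s t
      using le[of s t] le[of t s] that by (cases "s \<le> t") (auto simp: norm_minus_commute)
  qed
qed

text \<open>By Tychonoff's theorem the nested sets of approximately \<open>L\<close>-Lipschitz functions have a common
  element, and that is an \<open>L\<close>-Lipschitz path.\<close>

lemma length_dist_le:
  fixes X :: "'a::real_normed_vector set"
  assumes "compact X" "L \<ge> 0" and le: "\<And>\<epsilon>. \<epsilon> > 0 \<Longrightarrow> eps_dist \<epsilon> X x y \<le> ennreal L"
  shows "length_dist X x y \<le> ennreal L"
proof -
  define P where "P = product_topology (\<lambda>_. top_of_set X) {0..1::real}"
  \<comment> \<open>Every condition puts a continuous expression in evaluations of \<open>f\<close>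
    into a closed set, so \<open>C n\<close> is closed. Half of the error
    \<open>2 / real (Suc n)\<close> pays for the jumps, half for the excess speed.\<close>
  define C where "C n = {f \<in> topspace P. f 0 \<in> {x} \<and> f 1 \<in> {y} \<and>
      (\<forall>s\<in>{0..1}. \<forall>t\<in>{0..1}. norm (f s - f t) \<in> {..L * \<bar>s - t\<bar> + 2 / real (Suc n)})}" for n
  have cont: "continuous_map P euclidean (\<lambda>f. f t)" if "t \<in> {0..1}" for t
    using that continuous_map_product_projection[of t "{0..1}" "\<lambda>_. top_of_set X"]
    by (auto simp: P_def intro: continuous_map_into_fulltopology)
  have "\<Inter>(range C) \<noteq> {}"
  proof (rule compact_space_imp_nest)
    show "compact_space P"
      using \<open>compact X\<close> by (simp add: P_def compact_space_product_topology compact_space_subtopology)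
    show "closedin P (C n)" for n
    proof -
      have "C n = {f \<in> topspace P. f 0 \<in> {x}} \<inter> {f \<in> topspace P. f 1 \<in> {y}} \<inter>
        (\<Inter>(s, t)\<in>{0..1} \<times> {0..1}.
          {f \<in> topspace P. norm (f s - f t) \<in> {..L * \<bar>s - t\<bar> + 2 / real (Suc n)}})"
        by (auto simp: C_def)
      moreover have "closedin P {f \<in> topspace P. norm (f s - f t) \<in> {..c}}"
        if "s \<in> {0..1}" "t \<in> {0..1}" for s t c
        using that
        by (intro closedin_continuous_map_preimage[where Y = euclidean] continuous_map_norm
            continuous_map_diff cont) auto
      moreover have "closedin P {f \<in> topspace P. f t \<in> {c}}" if "t \<in> {0..1}" for t c
        using that by (intro closedin_continuous_map_preimage[where Y = euclidean] cont) auto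
      ultimately show ?thesis
        by (auto intro!: closedin_Int closedin_INT)
    qed
    show "C n \<noteq> {}" for n
    proof -
      define e where "e = 1 / real (Suc n)"
      have "e > 0" by (simp add: e_def)
      \<comment> \<open>The step function needs a strict bound, hence the speed
        \<open>L + e\<close>.\<close>
      have "eps_dist e X x y < ennreal (L + e)"
        using le[OF \<open>e > 0\<close>] \<open>e > 0\<close> \<open>L \<ge> 0\<close> by (simp add: le_less_trans ennreal_less_iff)
      then obtain f where f: "f \<in> {0..1} \<rightarrow> X" "f 0 = x" "f 1 = y"
        "\<And>s t. s \<in> {0..1} \<Longrightarrow> t \<in> {0..1} \<Longrightarrow> norm (f s - f t) \<le> (L + e) * \<bar>s - t\<bar> + e"
        using \<open>e > 0\<close> \<open>L \<ge> 0\<close> eps_path_step_function[of "L + e" e X x y] by auto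
      have "norm (f s - f t) \<le> L * \<bar>s - t\<bar> + 2 / real (Suc n)" if "s \<in> {0..1}" "t \<in> {0..1}" for s t
      proof -
        have "e * \<bar>s - t\<bar> \<le> e"
          using that \<open>e > 0\<close> by (auto intro!: mult_left_le)
        moreover have "2 / real (Suc n) = e + e"
          by (simp add: e_def)
        ultimately show ?thesis
          using f(4)[OF that] by (simp add: algebra_simps)
      qed
      \<comment> \<open>Points of the product space are \<open>undefined\<close> outside [0,1],
        hence the restriction.\<close>
      then have "restrict f {0..1} \<in> C n"
        using f by (auto simp: C_def P_def)
      then show ?thesis by blast
    qed
    show "decseq C"
    proof (rule decseq_SucI)
      fix n
      have "2 / real (Suc (Suc n)) \<le> 2 / real (Suc n)"
        by (simp add: frac_le)
      then show "C (Suc n) \<subseteq> C n"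
        unfolding C_def by (fastforce simp del: of_nat_Suc)
    qed
  qed
  then obtain g where g: "\<And>n. g \<in> C n" by blast
  \<comment> \<open>Membership in all \<open>C n\<close> lets the error tend to 0.\<close>
  have lip: "norm (g s - g t) \<le> L * \<bar>s - t\<bar>" if "s \<in> {0..1}" "t \<in> {0..1}" for s t
  proof (rule LIMSEQ_le_const)
    have "(\<lambda>n. 2 * inverse (real (Suc n))) \<longlonglongrightarrow> 2 * 0"
      by (intro tendsto_mult_left LIMSEQ_inverse_real_of_nat)
    then show "(\<lambda>n. L * \<bar>s - t\<bar> + 2 / real (Suc n)) \<longlonglongrightarrow> L * \<bar>s - t\<bar>"
      using tendsto_add[OF tendsto_const[of "L * \<bar>s - t\<bar>"]] by (fastforce simp: divide_inverse)
    show "\<exists>N. \<forall>n\<ge>N. norm (g s - g t) \<le> L * \<bar>s - t\<bar> + 2 / real (Suc n)"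
      using g that by (auto simp: C_def)
  qed
  have "L-lipschitz_on {0..1} g"
    using lip \<open>L \<ge> 0\<close> by (auto simp: lipschitz_on_def dist_norm)
  then have "continuous_on {0..1} g"
    by (rule lipschitz_on_continuous_on)
  moreover have "g ` {0..1} \<subseteq> X" "g 0 = x" "g 1 = y"
    using g[of 0] by (auto simp: C_def P_def)
  ultimately have "g \<in> paths_between X x y"
    by (simp add: paths_between_def path_def path_image_def pathstart_def pathfinish_def)
  then have "length_dist X x y \<le> path_length g"
    unfolding length_dist_def by (rule INF_lower)
  also have "\<dots> \<le> ennreal L"
    using \<open>L \<ge> 0\<close> lip by (rule path_length_lipschitz_le)
  finally show ?thesis .
qed

section \<open>The length distance as a supremum, and its metric properties\<close>

text \<open>Sampling gives one inequality. For the other, a finite supremum serves as the bound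
  \<open>L\<close> in \<open>length_dist_le\<close>, and an infinite one is trivial.\<close>

lemma length_dist_eq_SUP_eps_dist:
  fixes X :: "'a::real_normed_vector set"
  assumes "compact X"
  shows "length_dist X x y = (SUP \<epsilon>\<in>{0<..}. eps_dist \<epsilon> X x y)"
proof (rule antisym)
  show "length_dist X x y \<le> (SUP \<epsilon>\<in>{0<..}. eps_dist \<epsilon> X x y)" (is "_ \<le> ?S")
  proof (cases ?S)
    case (real L)
    have "eps_dist \<epsilon> X x y \<le> ?S" if "\<epsilon> > 0" for \<epsilon>
      using that by (intro SUP_upper) auto
    then show ?thesis
      using length_dist_le[OF assms, of L x y] real by simp
  next
    case top
    then show ?thesis by (simp only: top_greatest)
  qed
qed (auto intro!: SUP_least eps_dist_le_length_dist)

lemma length_dist_commute: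
  fixes X :: "'a::real_normed_vector set"
  assumes "compact X"
  shows "length_dist X x y = length_dist X y x"
  unfolding length_dist_eq_SUP_eps_dist[OF assms] by (simp add: eps_dist_commute)

text \<open>Each \<epsilon>-distance satisfies the inequality and is bounded by the length distance,
  so the supremum over \<epsilon> replaces a concatenation of paths.\<close>

lemma length_dist_triangle:
  fixes X :: "'a::real_normed_vector set"
  assumes "compact X"
  shows "length_dist X x z \<le> length_dist X x y + length_dist X y z"
  unfolding length_dist_eq_SUP_eps_dist[OF assms, of x z]
proof (rule SUP_least)
  fix \<epsilon> :: real assume "\<epsilon> \<in> {0<..}"
  then show "eps_dist \<epsilon> X x z \<le> length_dist X x y + length_dist X y z"
    by (intro order_trans[OF eps_dist_triangle[of _ _ x z y]] add_mono eps_dist_le_length_dist) auto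
qed

lemma length_dist_refl: "x \<in> X \<Longrightarrow> length_dist X x x = 0"
proof -
  assume "x \<in> X"
  then have "(\<lambda>_. x) \<in> paths_between X x x"
    by (auto simp: paths_between_def path_def path_image_def pathstart_def pathfinish_def)
  then have "length_dist X x x \<le> path_length (\<lambda>_. x)"
    unfolding length_dist_def by (rule INF_lower)
  also have "\<dots> \<le> ennreal 0"
    by (rule path_length_lipschitz_le) auto
  finally show ?thesis by simp
qed

section \<open>Topology of the length distance\<close>

lemma topspace_emetric_topology: "topspace (emetric_topology X d) = X"
proof -
  have "openin (emetric_topology X d) X"
    unfolding openin_emetric_topology by (auto intro: zero_less_one)
  then show ?thesis
    using openin_emetric_topology[of X d "topspace (emetric_topology X d)"] openin_subset by blast
qed

text \<open>A chord is no longer than a path between its ends, so the identity is continuous from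
  the length topology to the norm topology and carries compactness over.\<close>

lemma compact_if_compact_length_topology:
  fixes X :: "'a::real_normed_vector set"
  assumes "compact_space (emetric_topology X (length_dist X))"
  shows "compact X"
proof -
  let ?T = "emetric_topology X (length_dist X)"
  have "continuous_map ?T euclidean id"
  proof (clarsimp simp: continuous_map_def topspace_emetric_topology openin_emetric_topology)
    fix U :: "'a set" and x assume "open U" "x \<in> U" "x \<in> X"
    then obtain r where "r > 0" and r: "ball x r \<subseteq> U"
      by (meson open_contains_ball)
    have "y \<in> U" if "length_dist X x y < ennreal r" for y
      using le_less_trans[OF norm_le_length_dist that] r \<open>r > 0\<close>
      by (auto simp: ennreal_less_iff dist_norm)
    then show "\<exists>r>0. {y \<in> X. length_dist X x y < ennreal r} \<subseteq> {x \<in> X. x \<in> U}"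
      using \<open>r > 0\<close> by blast
  qed
  then have "compactin euclidean (id ` topspace ?T)"
    using assms by (intro image_compactin) (auto simp: compact_space_def)
  then show ?thesis
    by (simp add: topspace_emetric_topology)
qed

text \<open>The radius may be infinite, because the set of points at finite distance from
  \<open>x\<close> is also such a ball.\<close>

lemma openin_length_ball:
  fixes X :: "'a::real_normed_vector set"
  assumes "compact X"
  shows "openin (emetric_topology X (length_dist X)) {y \<in> X. length_dist X x y < c}"
  unfolding openin_emetric_topology
proof (intro conjI ballI)
  fix y assume "y \<in> {y \<in> X. length_dist X x y < c}"
  then have "length_dist X x y < c" by simp
  \<comment> \<open>Being below \<open>c\<close>, the value \<open>b\<close> is finite even for
    infinite \<open>c\<close>, so the gap \<open>r\<close> is a real radius.\<close>
  then obtain b where b: "length_dist X x y < b" "b < c"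
    using dense by blast
  define r where "r = enn2real (b - length_dist X x y)"
  have "b - length_dist X x y \<noteq> 0" "b - length_dist X x y < top"
    using b by (auto simp: diff_eq_0_iff_ennreal less_top[symmetric] ennreal_minus_eq_top)
  then have "r > 0"
    by (simp add: r_def enn2real_positive_iff zero_less_iff_neq_zero)
  have "length_dist X x y + ennreal r = b"
    using b \<open>b - length_dist X x y < top\<close> by (simp add: r_def add_diff_inverse_ennreal)
  then have r: "length_dist X x y + ennreal r < c"
    using b by simp
  have "length_dist X x z < c" if "length_dist X y z < ennreal r" for z
  proof -
    have "length_dist X x z \<le> length_dist X x y + length_dist X y z"
      by (rule length_dist_triangle[OF assms])
    also have "\<dots> \<le> length_dist X x y + ennreal r"
      using that by (intro add_mono) auto
    finally show ?thesis using r by simp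
  qed
  then show "\<exists>r>0. {z \<in> X. length_dist X y z < ennreal r} \<subseteq> {y \<in> X. length_dist X x y < c}"
    using \<open>r > 0\<close> by blast
qed auto

text \<open>The points at finite distance from \<open>x\<close> form a nonempty open and closed set,
  which by connectedness is all of \<open>X\<close>.\<close>

lemma length_dist_finite:
  fixes X :: "'a::real_normed_vector set"
  assumes "compact X" "connected_space (emetric_topology X (length_dist X))" "x \<in> X" "y \<in> X"
  shows "length_dist X x y < \<infinity>"
proof -
  let ?T = "emetric_topology X (length_dist X)" and ?B = "{y \<in> X. length_dist X x y < \<infinity>}"
  have "openin ?T ?B"
    using assms by (intro openin_length_ball) auto
  \<comment> \<open>A point closer than 1 to a point at infinite distance from \<open>x\<close> is
    itself infinitely far from \<open>x\<close>.\<close>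
  moreover have "openin ?T (X - ?B)"
    unfolding openin_emetric_topology
  proof (intro conjI ballI)
    fix y assume y: "y \<in> X - ?B"
    have "z \<in> X - ?B" if "z \<in> X" "length_dist X y z < ennreal 1" for z
    proof -
      have "length_dist X x y \<le> length_dist X x z + length_dist X y z"
        using length_dist_triangle[OF assms(1), of x y z] length_dist_commute[OF assms(1), of y z]
        by simp
      moreover have "length_dist X y z < top"
        using that by (metis ennreal_less_top less_trans)
      ultimately show ?thesis
        using y that by (auto simp: less_top[symmetric] top_unique ennreal_add_eq_top)
    qed
    then show "\<exists>r>0. {z \<in> X. length_dist X y z < ennreal r} \<subseteq> X - ?B"
      by (intro exI[of _ 1]) auto
  qed auto
  then have "closedin ?T ?B"
    by (auto simp: closedin_def topspace_emetric_topology)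
  ultimately have "?B = {} \<or> ?B = X"
    using assms(2) by (auto simp: connected_space_clopen_in topspace_emetric_topology)
  moreover have "x \<in> ?B"
    using assms by (simp add: length_dist_refl)
  ultimately show ?thesis
    using \<open>y \<in> X\<close> by blast
qed

section \<open>Pointwise and uniform convergence\<close>

text \<open>Some \<delta> comes within \<eta> of the finite supremum, and passing to smaller
  \<epsilon> can only increase the \<epsilon>-distance.\<close>

lemma eventually_length_dist_le_eps_dist:
  fixes X :: "'a::real_normed_vector set"
  assumes "compact X" "length_dist X x y < \<infinity>" "\<eta> > 0"
  shows "\<forall>\<^sub>F \<epsilon> in at_right 0. length_dist X x y \<le> eps_dist \<epsilon> X x y + ennreal \<eta>"
proof -
  have "\<exists>\<delta>\<in>{0<..}. length_dist X x y < eps_dist \<delta> X x y + ennreal \<eta>"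
    using assms
    by (intro SUP_approx_ennreal[OF _ _ length_dist_eq_SUP_eps_dist[OF assms(1)]]) auto
  then obtain \<delta> where \<delta>: "\<delta> > 0" "length_dist X x y \<le> eps_dist \<delta> X x y + ennreal \<eta>"
    using less_imp_le by blast
  have "\<forall>\<^sub>F \<epsilon> in at_right 0. \<epsilon> < \<delta>"
    using \<open>\<delta> > 0\<close> eventually_at_right_field by blast
  then show ?thesis
    by eventually_elim (use \<delta> in \<open>auto intro!: order_trans[OF \<delta>(2)] add_mono eps_dist_antimono\<close>)
qed

text \<open>Both distances are 1-Lipschitz for the length metric, so pointwise convergence on the pairs of
  a finite net gives uniform convergence.\<close>

lemma eventually_length_dist_le_eps_dist_uniform:
  fixes X :: "'a::real_normed_vector set"
  assumes T: "compact_space (emetric_topology X (length_dist X))"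
    and fin: "\<And>x y. x \<in> X \<Longrightarrow> y \<in> X \<Longrightarrow> length_dist X x y < \<infinity>" and "\<eta> > 0"
  shows "\<forall>\<^sub>F \<epsilon> in at_right 0. \<forall>x\<in>X. \<forall>y\<in>X. length_dist X x y \<le> eps_dist \<epsilon> X x y + ennreal (5 * \<eta>)"
proof -
  let ?T = "emetric_topology X (length_dist X)"
  note X = compact_if_compact_length_topology[OF T]
  define B where "B z = {y \<in> X. length_dist X z y < ennreal \<eta>}" for z
  have "\<exists>\<F>. finite \<F> \<and> \<F> \<subseteq> B ` X \<and> topspace ?T \<subseteq> \<Union>\<F>"
  proof (rule compactinD)
    show "compactin ?T (topspace ?T)"
      using T by (simp add: compact_space_def)
    show "openin ?T U" if "U \<in> B ` X" for U
      using that \<open>\<eta> > 0\<close> openin_length_ball[OF X] by (auto simp: B_def)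
    show "topspace ?T \<subseteq> \<Union>(B ` X)"
      using \<open>\<eta> > 0\<close> by (auto simp: topspace_emetric_topology B_def length_dist_refl)
  qed
  then obtain Z where Z: "finite Z" "Z \<subseteq> X" "X \<subseteq> (\<Union>z\<in>Z. B z)"
    by (metis finite_subset_image topspace_emetric_topology)
  \<comment> \<open>Finitely many pairs from \<open>Z\<close> occur, so the pointwise estimates hold
    simultaneously.\<close>
  have "\<forall>\<^sub>F \<epsilon> in at_right 0. \<forall>p\<in>Z. \<forall>q\<in>Z. length_dist X p q \<le> eps_dist \<epsilon> X p q + ennreal \<eta>"
    using Z \<open>\<eta> > 0\<close>
    by (intro eventually_ball_finite ballI eventually_length_dist_le_eps_dist X fin) auto
  moreover have "\<forall>\<^sub>F \<epsilon> in at_right 0. 0 < (\<epsilon>::real)"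
    by (rule eventually_at_right_less)
  ultimately show ?thesis
  proof eventually_elim
    case (elim \<epsilon>)
    show ?case
    proof (intro ballI)
      fix x y assume "x \<in> X" "y \<in> X"
      then obtain p q where pq: "p \<in> Z" "q \<in> Z"
        "length_dist X p x \<le> ennreal \<eta>" "length_dist X q y \<le> ennreal \<eta>"
        using Z(3) unfolding B_def by (blast intro: less_imp_le)
      have eps: "eps_dist \<epsilon> X p x \<le> ennreal \<eta>" "eps_dist \<epsilon> X q y \<le> ennreal \<eta>"
        using pq eps_dist_le_length_dist[OF elim(2)] order_trans by blast+
      \<comment> \<open>Three of the five \<eta>: two for moving \<open>x\<close> and
        \<open>y\<close> to net points, one for convergence on the net.\<close>
      have "length_dist X x y \<le> length_dist X p x + (length_dist X p q + length_dist X q y)"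
        using length_dist_triangle[OF X, of x y p] length_dist_triangle[OF X, of p y q]
          length_dist_commute[OF X, of x p] by (metis add_left_mono order_trans)
      also have "\<dots> \<le> ennreal \<eta> + ((eps_dist \<epsilon> X p q + ennreal \<eta>) + ennreal \<eta>)"
        using pq elim by (intro add_mono) auto
      \<comment> \<open>The remaining two \<eta> pay for moving back from \<open>p\<close> and
        \<open>q\<close> to \<open>x\<close> and \<open>y\<close> in the
        \<epsilon>-distance.\<close>
      also have "eps_dist \<epsilon> X p q \<le> eps_dist \<epsilon> X p x + (eps_dist \<epsilon> X x y + eps_dist \<epsilon> X q y)"
        using eps_dist_triangle[of \<epsilon> X p q x] eps_dist_triangle[of \<epsilon> X x q y]
          eps_dist_commute[of \<epsilon> X y q] by (metis add_left_mono order_trans)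
      also have "\<dots> \<le> ennreal \<eta> + (eps_dist \<epsilon> X x y + ennreal \<eta>)"
        using eps by (intro add_mono) auto
      also have "ennreal \<eta> + (ennreal \<eta> + (eps_dist \<epsilon> X x y + ennreal \<eta>) + ennreal \<eta> + ennreal \<eta>)
          = eps_dist \<epsilon> X x y + (ennreal \<eta> + ennreal \<eta> + ennreal \<eta> + ennreal \<eta> + ennreal \<eta>)"
        by (simp add: ac_simps)
      also have "ennreal \<eta> + ennreal \<eta> + ennreal \<eta> + ennreal \<eta> + ennreal \<eta> = ennreal (5 * \<eta>)"
        using \<open>\<eta> > 0\<close> by (simp flip: ennreal_plus)
      finally show "length_dist X x y \<le> eps_dist \<epsilon> X x y + ennreal (5 * \<eta>)"
        by (auto simp: add_mono)
    qed
  qed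
qed

theorem theorem4p9:
  fixes X :: "(real ^ 'n) set"
  assumes "geodesic_subspace X"
    and "compact_space (emetric_topology X (length_dist X))"
    and "path_connected_space (emetric_topology X (length_dist X))"
  shows "(\<forall>x\<in>X. \<forall>y\<in>X. length_dist X x y < \<infinity>) \<and>
         (\<forall>\<epsilon>>0. \<forall>x\<in>X. \<forall>y\<in>X. eps_dist \<epsilon> X x y < \<infinity>) \<and>
         uniform_limit (X \<times> X)
           (\<lambda>\<epsilon> (x, y). enn2real (eps_dist \<epsilon> X x y))
           (\<lambda>(x, y). enn2real (length_dist X x y))
           (at_right 0)"
proof -
  have fin: "length_dist X x y < \<infinity>" if "x \<in> X" "y \<in> X" for x y
    using assms(2,3) that
    by (intro length_dist_finite compact_if_compact_length_topology
        path_connected_imp_connected_space)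
  have eps_fin: "eps_dist \<epsilon> X x y < \<infinity>" if "\<epsilon> > 0" "x \<in> X" "y \<in> X" for \<epsilon> x y
    using eps_dist_le_length_dist[OF that(1)] fin[OF that(2,3)] by (rule le_less_trans)
  have "uniform_limit (X \<times> X) (\<lambda>\<epsilon> (x, y). enn2real (eps_dist \<epsilon> X x y))
      (\<lambda>(x, y). enn2real (length_dist X x y)) (at_right 0)"
  proof (rule uniform_limitI)
    fix e :: real assume "e > 0"
    \<comment> \<open>With \<eta> = e/10 the total error is e/2, which leaves room for the strict
      inequality.\<close>
    then have "\<forall>\<^sub>F \<epsilon> in at_right 0. \<forall>x\<in>X. \<forall>y\<in>X.
        length_dist X x y \<le> eps_dist \<epsilon> X x y + ennreal (5 * (e / 10))"
      using assms(2) fin by (intro eventually_length_dist_le_eps_dist_uniform) auto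
    moreover have "\<forall>\<^sub>F \<epsilon> in at_right 0. 0 < (\<epsilon>::real)"
      by (rule eventually_at_right_less)
    ultimately show "\<forall>\<^sub>F \<epsilon> in at_right 0. \<forall>p\<in>X \<times> X.
        dist (case p of (x, y) \<Rightarrow> enn2real (eps_dist \<epsilon> X x y))
          (case p of (x, y) \<Rightarrow> enn2real (length_dist X x y)) < e"
    proof eventually_elim
      case (elim \<epsilon>)
      have "dist (enn2real (eps_dist \<epsilon> X x y)) (enn2real (length_dist X x y)) < e"
        if "x \<in> X" "y \<in> X" for x y
      proof -
        \<comment> \<open>Since \<open>enn2real\<close> sends infinity to 0, finiteness is what lets
          the extended inequalities pass to the reals.\<close>
        obtain a where a: "a \<ge> 0" "eps_dist \<epsilon> X x y = ennreal a"
          using eps_fin[OF elim(2) \<open>x \<in> X\<close> \<open>y \<in> X\<close>] by (cases "eps_dist \<epsilon> X x y") auto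
        obtain b where b: "b \<ge> 0" "length_dist X x y = ennreal b"
          using fin[OF \<open>x \<in> X\<close> \<open>y \<in> X\<close>] by (cases "length_dist X x y") auto
        \<comment> \<open>This direction holds for every positive \<epsilon>; the uniform estimate
          serves the other one.\<close>
        have "a \<le> b"
          using eps_dist_le_length_dist[OF elim(2), of X x y] a b by simp
        moreover have "b \<le> a + e / 2"
          using elim(1) that a b \<open>e > 0\<close> by (force simp flip: ennreal_plus)
        ultimately show ?thesis
          using a b \<open>e > 0\<close> by (simp add: dist_real_def)
      qed
      then show ?case by auto
    qed
  qed
  then show ?thesis
    using fin eps_fin by blast
qed

end
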